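(* For any set $X$, the center of $\mathcal{M}(X)$ consists only of the left zeros and the right zeros operations, i.e. $Z(\mathcal{M}(X))=\{\circ_{lz},\circ_{rz}\}$.
   Context: $\mathcal{M}(X)=X^{X\times X}$ is the set of all binary operations on $X$, a monoid under $\triangleright$ defined by $a(\circ\triangleright\ast)b=(a\circ b)\ast(b\circ a)$ for all $a,b\in X$. The left zeros operation is $a\circ_{lz}b=a$ and the right zeros operation is $a\circ_{rz}b=b$ for all $a,b\in X$. The center is $Z(\mathcal{M}(X))=\{\ast\in\mathcal{M}(X):\ast\triangleright\circ=\circ\triangleright\ast\text{ for all }\circ\in\mathcal{M}(X)\}$. *)

theory Defs
  imports "HOL-Algebra.Group" "HOL-Library.FuncSet"
begin

text \<open>
  The binary operations on a set \<open>X\<close> are the functions from \<open>X \<times> X\<close> to \<open>X\<close>. They are taken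
  extensional (\<open>undefined\<close> off \<open>X \<times> X\<close>), so that HOL equality is equality as functions on
  \<open>X \<times> X\<close>. The carrier set \<open>X\<close> may be empty, finite or infinite.
\<close>

definition binops :: "'a set \<Rightarrow> ('a \<times> 'a \<Rightarrow> 'a) set" where
  "binops X = (X \<times> X) \<rightarrow>\<^sub>E X"

definition binop_prod ::
    "'a set \<Rightarrow> ('a \<times> 'a \<Rightarrow> 'a) \<Rightarrow> ('a \<times> 'a \<Rightarrow> 'a) \<Rightarrow> ('a \<times> 'a \<Rightarrow> 'a)" where
  "binop_prod X f g = (\<lambda>(a, b) \<in> X \<times> X. g (f (a, b), f (b, a)))"

definition left_zeros :: "'a set \<Rightarrow> ('a \<times> 'a \<Rightarrow> 'a)" where
  "left_zeros X = (\<lambda>(a, b) \<in> X \<times> X. a)"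

definition right_zeros :: "'a set \<Rightarrow> ('a \<times> 'a \<Rightarrow> 'a)" where
  "right_zeros X = (\<lambda>(a, b) \<in> X \<times> X. b)"

definition binop_monoid :: "'a set \<Rightarrow> ('a \<times> 'a \<Rightarrow> 'a) monoid" where
  "binop_monoid X = \<lparr>carrier = binops X, mult = binop_prod X, one = left_zeros X\<rparr>"

definition monoid_center :: "('a, 'b) monoid_scheme \<Rightarrow> 'a set" where
  "monoid_center G = {z \<in> carrier G. \<forall>g \<in> carrier G. z \<otimes>\<^bsub>G\<^esub> g = g \<otimes>\<^bsub>G\<^esub> z}"

lemma binops_closed: "f \<in> binops X \<Longrightarrow> a \<in> X \<Longrightarrow> b \<in> X \<Longrightarrow> f (a, b) \<in> X"
  by (auto simp: binops_def)

lemma monoid_binop_monoid: "monoid (binop_monoid X)"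
proof (rule monoidI)
  fix f g assume "f \<in> carrier (binop_monoid X)" "g \<in> carrier (binop_monoid X)"
  then show "f \<otimes>\<^bsub>binop_monoid X\<^esub> g \<in> carrier (binop_monoid X)"
    by (auto simp: binop_monoid_def binops_def binop_prod_def)
next
  show "\<one>\<^bsub>binop_monoid X\<^esub> \<in> carrier (binop_monoid X)"
    by (auto simp: binop_monoid_def binops_def left_zeros_def)
next
  fix f g h
  assume "f \<in> carrier (binop_monoid X)" "g \<in> carrier (binop_monoid X)"
    "h \<in> carrier (binop_monoid X)"
  then show "f \<otimes>\<^bsub>binop_monoid X\<^esub> g \<otimes>\<^bsub>binop_monoid X\<^esub> h
      = f \<otimes>\<^bsub>binop_monoid X\<^esub> (g \<otimes>\<^bsub>binop_monoid X\<^esub> h)"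
    by (auto simp: binop_monoid_def binop_prod_def binops_closed intro!: restrict_ext)
next
  fix f assume "f \<in> carrier (binop_monoid X)"
  then have f: "f \<in> binops X" by (simp add: binop_monoid_def)
  show "\<one>\<^bsub>binop_monoid X\<^esub> \<otimes>\<^bsub>binop_monoid X\<^esub> f = f"
  proof (rule extensionalityI[of _ "X \<times> X"])
    show "f \<in> extensional (X \<times> X)" using f by (simp add: binops_def PiE_def)
  qed (auto simp: binop_monoid_def binop_prod_def left_zeros_def)
  show "f \<otimes>\<^bsub>binop_monoid X\<^esub> \<one>\<^bsub>binop_monoid X\<^esub> = f"
  proof (rule extensionalityI[of _ "X \<times> X"])
    show "f \<in> extensional (X \<times> X)" using f by (simp add: binops_def PiE_def)
  qed (use f in \<open>auto simp: binop_monoid_def binop_prod_def left_zeros_def binops_closed\<close>)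
qed

end

theory Submission
  imports Defs
begin

text \<open>
  Let \<open>z\<close> be central and \<open>a \<noteq> b\<close>. Commuting \<open>z\<close> with an operation that takes the values \<open>x\<close> at
  \<open>(a, b)\<close> and \<open>y\<close> at \<open>(b, a)\<close> and the constant value \<open>w\<close> elsewhere expresses \<open>z (x, y)\<close> as the
  value of that operation at \<open>(z (a, b), z (b, a))\<close>. Since \<open>w\<close> is arbitrary, this pair must be
  \<open>(a, b)\<close> or \<open>(b, a)\<close>, and then \<open>z (x, y)\<close> is always \<open>x\<close> or always \<open>y\<close>.
\<close>

lemma binops_eqI:
  assumes "f \<in> binops X" "g \<in> binops X"
    and "\<And>x y. x \<in> X \<Longrightarrow> y \<in> X \<Longrightarrow> f (x, y) = g (x, y)"
  shows "f = g"
  using assms unfolding binops_def by (intro PiE_ext[of f _ _ g]) auto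

lemma left_zeros_in_binops: "left_zeros X \<in> binops X"
  by (auto simp: left_zeros_def binops_def)

lemma right_zeros_in_binops: "right_zeros X \<in> binops X"
  by (auto simp: right_zeros_def binops_def)

lemma left_zeros_central: "left_zeros X \<in> monoid_center (binop_monoid X)"
proof -
  interpret monoid "binop_monoid X" by (rule monoid_binop_monoid)
  have "\<one>\<^bsub>binop_monoid X\<^esub> \<in> monoid_center (binop_monoid X)"
    by (simp add: monoid_center_def)
  then show ?thesis by (simp add: binop_monoid_def)
qed

text \<open>Multiplying \<open>g\<close> by the right zeros on either side gives the opposite
  operation, with value \<open>g (b, a)\<close> at \<open>(a, b)\<close>.\<close>

lemma right_zeros_central: "right_zeros X \<in> monoid_center (binop_monoid X)"
  by (auto simp: monoid_center_def binop_monoid_def binop_prod_def right_zeros_in_binops[unfolded right_zeros_def]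
      right_zeros_def binops_closed intro!: restrict_ext)

lemma central_apply:
  assumes "z \<in> monoid_center (binop_monoid X)" "f \<in> binops X" "a \<in> X" "b \<in> X"
  shows "f (z (a, b), z (b, a)) = z (f (a, b), f (b, a))"
proof -
  have "binop_prod X z f = binop_prod X f z"
    using assms by (simp add: monoid_center_def binop_monoid_def)
  then have "binop_prod X z f (a, b) = binop_prod X f z (a, b)" by simp
  then show ?thesis using assms by (simp add: binop_prod_def)
qed

lemma central_imp_left_or_right_zeros:
  assumes z: "z \<in> monoid_center (binop_monoid X)"
  shows "z = left_zeros X \<or> z = right_zeros X"
proof (cases "\<exists>a\<in>X. \<exists>b\<in>X. a \<noteq> b")
  case False
  have zX: "z \<in> binops X" using z by (simp add: monoid_center_def binop_monoid_def)
  \<comment> \<open>Here \<open>X\<close> has at most one element, so any two operations on it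
    agree.\<close>
  have "z = left_zeros X"
    using zX left_zeros_in_binops
    by (rule binops_eqI) (meson False binops_closed zX left_zeros_in_binops)
  then show ?thesis ..
next
  case True
  then obtain a b where ab: "a \<in> X" "b \<in> X" "a \<noteq> b" by blast
  have zX: "z \<in> binops X" using z by (simp add: monoid_center_def binop_monoid_def)
  define p where "p = (z (a, b), z (b, a))"
  have pX: "p \<in> X \<times> X" using binops_closed[OF zX] ab by (simp add: p_def)
  have key: "z (x, y) = (if p = (a, b) then x else if p = (b, a) then y else w)"
    if "x \<in> X" "y \<in> X" "w \<in> X" for x y w
  proof -
    define f where
      "f = (\<lambda>q \<in> X \<times> X. if q = (a, b) then x else if q = (b, a) then y else w)"
    have "f \<in> binops X" using that by (auto simp: f_def binops_def)
    from central_apply[OF z this ab(1,2)] have "z (x, y) = f p"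
      using ab by (simp add: f_def p_def)
    then show ?thesis using pX by (simp add: f_def)
  qed
  \<comment> \<open>For any other \<open>p\<close>, the choices \<open>w = a\<close> and
    \<open>w = b\<close> would force \<open>z (a, a)\<close> to equal both \<open>a\<close> and
    \<open>b\<close>.\<close>
  consider "p = (a, b)" | "p = (b, a)"
    using key[of a a a] key[of a a b] ab by (auto split: if_splits)
  then show ?thesis
  proof cases
    case 1
    have "z = left_zeros X"
      using zX left_zeros_in_binops
      by (rule binops_eqI) (use key 1 in \<open>auto simp: left_zeros_def\<close>)
    then show ?thesis ..
  next
    case 2
    \<comment> \<open>As \<open>a \<noteq> b\<close>, the pair \<open>(b, a)\<close> differs from
      \<open>(a, b)\<close>, so \<open>key\<close> selects its second branch,
      \<open>y\<close>.\<close>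
    have "z = right_zeros X"
      using zX right_zeros_in_binops
      by (rule binops_eqI) (use key 2 ab in \<open>auto simp: right_zeros_def\<close>)
    then show ?thesis ..
  qed
qed

theorem proposition27:
  fixes X :: "'a set"
  shows "monoid_center (binop_monoid X) = {left_zeros X, right_zeros X}"
  using central_imp_left_or_right_zeros left_zeros_central right_zeros_central by blast

end
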